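(* For every $(p,q)\in(\mathbb{N}^* )^2$, the sequence $\left(S_{p,q}^{(n)}\right)_{n\in\mathbb{N}}$ of partial sums $S_{p,q}^{(n)}=\sum_{k=0}^{n}\frac{(-1)^k}{pk+q}$ converges infra-linearly to $S_{p,q}=\sum_{k=0}^{+\infty}\frac{(-1)^k}{pk+q}$, with $$\left|S_{p,q}^{(n)}-S_{p,q}\right|\underset{n\to+\infty}{\sim}\frac{1}{2pn}.$$
   Context: $\mathbb{N}^*$ denotes the positive integers and $\mathbb{N}$ the nonnegative integers. A real sequence $(u_n)_{n\in\mathbb{N}}$ converging to a real $\ell$ is said to converge infra-linearly if the sequence of ratios $\left|\frac{u_{n+1}-\ell}{u_n-\ell}\right|$ is defined and converges to $1$. The notation $a_n\sim_{n\to+\infty} b_n$ means $a_n/b_n\to 1$. *)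

theory Defs
  imports Complex_Main "HOL-Library.Landau_Symbols"
begin

definition infra_linear_convergence :: "(nat \<Rightarrow> real) \<Rightarrow> real \<Rightarrow> bool" where
  "infra_linear_convergence u l \<longleftrightarrow>
     u \<longlonglongrightarrow> l \<and>
     \<comment> \<open>the ratios are defined (division by zero is total in HOL)\<close>
     (\<forall>n. u n \<noteq> l) \<and>
     (\<lambda>n. \<bar>(u (Suc n) - l) / (u n - l)\<bar>) \<longlonglongrightarrow> 1"

definition S_term :: "nat \<Rightarrow> nat \<Rightarrow> nat \<Rightarrow> real" where
  "S_term p q k = (-1) ^ k / (real p * real k + real q)"

definition S_partial :: "nat \<Rightarrow> nat \<Rightarrow> nat \<Rightarrow> real" where
  "S_partial p q n = (\<Sum>k=0..n. S_term p q k)"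

definition S_total :: "nat \<Rightarrow> nat \<Rightarrow> real" where
  "S_total p q = (\<Sum>k. S_term p q k)"

end

theory Submission
  imports Defs "HOL-Real_Asymp.Real_Asymp"
begin

text \<open>
  Put \<open>a k = 1 / (p k + q)\<close> and let \<open>r n\<close> be the error \<open>\<bar>S n - S\<bar>\<close>, so that
  \<open>r n + r (n + 1) = a (n + 1)\<close>. As \<open>a\<close> is convex, both \<open>2 r n - a (n + 1)\<close> and
  \<open>a n - 2 r n\<close> decrease when \<open>n\<close> grows by 2; as they tend to 0, they are nonnegative. The
  resulting enclosure \<open>a (n + 1) \<le> 2 r n \<le> a n\<close> determines the asymptotics of \<open>r n\<close> and of
  \<open>r (n + 1) / r n\<close>.
\<close>

text \<open>The indices of the parity of \<open>n\<close> carry a decreasing subsequence that still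
  tends to 0, and a decreasing sequence stays above its limit.\<close>

lemma nonneg_if_antimono_step2_null:
  fixes f :: "nat \<Rightarrow> real"
  assumes step: "\<And>n. f (n + 2) \<le> f n" and lim: "f \<longlonglongrightarrow> 0"
  shows "0 \<le> f n"
proof -
  have "decseq (\<lambda>k. f (n + 2 * k))"
    using step[of "n + 2 * k" for k] by (intro decseq_SucI) (simp add: algebra_simps)
  moreover have "(\<lambda>k. f (n + 2 * k)) \<longlonglongrightarrow> 0"
    by (rule filterlim_compose[OF lim]) real_asymp
  ultimately have "0 \<le> f (n + 2 * 0)"
    by (rule decseq_ge)
  then show ?thesis by simp
qed

lemma alternating_remainder_bounds:
  fixes a r :: "nat \<Rightarrow> real"
  assumes a: "a \<longlonglongrightarrow> 0" and r: "r \<longlonglongrightarrow> 0"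
    and rec: "\<And>n. r n + r (Suc n) = a (Suc n)"
    and convex: "\<And>n. 2 * a (Suc n) \<le> a n + a (Suc (Suc n))"
  shows "a (Suc n) \<le> 2 * r n" and "2 * r n \<le> a n"
proof -
  have "0 \<le> 2 * r n - a (Suc n)"
  proof (rule nonneg_if_antimono_step2_null[where f = "\<lambda>n. 2 * r n - a (Suc n)"])
    \<comment> \<open>Subtracting consecutive instances of \<open>rec\<close> gives
      \<open>r (n + 2) - r n = a (n + 2) - a (n + 1)\<close>. The claim thus reduces to convexity at
      \<open>n + 1\<close>; the second enclosure below uses it at \<open>n\<close>.\<close>
    show "2 * r (n + 2) - a (Suc (n + 2)) \<le> 2 * r n - a (Suc n)" for n
      using rec[of n] rec[of "Suc n"] convex[of "Suc n"] by simp
    show "(\<lambda>n. 2 * r n - a (Suc n)) \<longlonglongrightarrow> 0"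
      using tendsto_diff[OF tendsto_mult_left[OF r, of 2] LIMSEQ_Suc[OF a]] by simp
  qed
  then show "a (Suc n) \<le> 2 * r n" by simp
  have "0 \<le> a n - 2 * r n"
  proof (rule nonneg_if_antimono_step2_null[where f = "\<lambda>n. a n - 2 * r n"])
    show "a (n + 2) - 2 * r (n + 2) \<le> a n - 2 * r n" for n
      using rec[of n] rec[of "Suc n"] convex[of n] by simp
    show "(\<lambda>n. a n - 2 * r n) \<longlonglongrightarrow> 0"
      using tendsto_diff[OF a tendsto_mult_left[OF r, of 2]] by simp
  qed
  then show "2 * r n \<le> a n" by simp
qed

lemma inverse_affine_convex:
  fixes x p :: real
  assumes "x > 0" "p \<ge> 0"
  shows "2 * (1 / (x + p)) \<le> 1 / x + 1 / (x + 2 * p)"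
proof -
  have "1 / x + 1 / (x + 2 * p) - 2 * (1 / (x + p)) = 2 * p\<^sup>2 / (x * (x + p) * (x + 2 * p))"
    using assms by (simp add: divide_simps add_pos_nonneg power2_eq_square) algebra
  also have "\<dots> \<ge> 0" using assms by simp
  finally show ?thesis by simp
qed

lemma S_partial_tendsto_S_total:
  assumes "p > 0" "q > 0"
  shows "S_partial p q \<longlonglongrightarrow> S_total p q"
proof -
  have lim: "(\<lambda>k. 1 / (real p * real k + real q)) \<longlonglongrightarrow> 0"
    using assms by real_asymp
  have "decseq (\<lambda>k. 1 / (real p * real k + real q))"
    using assms by (intro decseq_SucI frac_le) (auto simp: add_nonneg_pos)
  then have "summable (\<lambda>k. (-1) ^ k * (1 / (real p * real k + real q)))"
    by (intro summable_Leibniz(1)[OF lim]) (simp add: monoseq_iff)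
  then have "S_term p q sums S_total p q"
    by (simp add: S_total_def S_term_def[abs_def] summable_sums)
  then show ?thesis
    \<comment> \<open>\<open>sums_def_le\<close> takes partial sums that include the index
      \<open>n\<close>, as \<open>S_partial\<close> does.\<close>
    by (simp add: sums_def_le S_partial_def[abs_def] atLeast0AtMost)
qed

lemma S_error_bounds:
  fixes p q n :: nat
  assumes "p > 0" "q > 0"
  defines "a \<equiv> \<lambda>k. 1 / (real p * real k + real q)"
  shows "a (Suc n) \<le> 2 * \<bar>S_partial p q n - S_total p q\<bar>"
    and "2 * \<bar>S_partial p q n - S_total p q\<bar> \<le> a n"
proof -
  \<comment> \<open>The sign turns the error into \<open>a (n + 1) - a (n + 2) + ...\<close>, which
    gives a linear recurrence without knowing the sign of the error in advance.\<close>
  define r where "r n = (-1) ^ n * (S_partial p q n - S_total p q)" for n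
  have a: "a \<longlonglongrightarrow> 0"
    using assms(1,2) unfolding a_def by real_asymp
  have "(\<lambda>n. S_partial p q n - S_total p q) \<longlonglongrightarrow> 0"
    using S_partial_tendsto_S_total[OF assms(1,2)] by (simp add: LIM_zero)
  then have r: "r \<longlonglongrightarrow> 0"
    by (subst tendsto_rabs_zero_iff[symmetric])
       (simp add: r_def abs_mult power_abs tendsto_rabs_zero)
  have rec: "r n + r (Suc n) = a (Suc n)" for n
    by (simp add: r_def a_def S_partial_def S_term_def algebra_simps flip: power_add)
  have convex: "2 * a (Suc n) \<le> a n + a (Suc (Suc n))" for n
  proof -
    have "0 < real p * real n + real q"
      using assms(2) by (simp add: add_nonneg_pos)
    from inverse_affine_convex[OF this, of "real p"] show ?thesis
      by (simp add: a_def algebra_simps)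
  qed
  note bounds = alternating_remainder_bounds[OF a r rec convex, of n]
  \<comment> \<open>The lower bound now shows that \<open>r n\<close> is nonnegative, hence equal to
    the absolute error.\<close>
  have "0 \<le> a (Suc n)" by (simp add: a_def)
  then have "r n = \<bar>r n\<bar>" using bounds by simp
  also have "\<dots> = \<bar>S_partial p q n - S_total p q\<bar>"
    by (simp add: r_def abs_mult power_abs)
  finally have "r n = \<bar>S_partial p q n - S_total p q\<bar>" .
  then show "a (Suc n) \<le> 2 * \<bar>S_partial p q n - S_total p q\<bar>"
    and "2 * \<bar>S_partial p q n - S_total p q\<bar> \<le> a n"
    using bounds by simp_all
qed

theorem mainTheorem1:
  fixes p q :: nat
  assumes "p > 0" and "q > 0"
  shows "infra_linear_convergence (S_partial p q) (S_total p q) \<and>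
         (\<lambda>n. \<bar>S_partial p q n - S_total p q\<bar>) \<sim>[sequentially] (\<lambda>n. 1 / (2 * real p * real n))"
proof -
  define a where "a k = 1 / (real p * real k + real q)" for k
  define r where "r n = \<bar>S_partial p q n - S_total p q\<bar>" for n
  have lower: "a (Suc n) \<le> 2 * r n" and upper: "2 * r n \<le> a n" for n
    using S_error_bounds[OF assms, of n] by (simp_all add: a_def r_def)
  have a_pos: "a n > 0" for n
    using assms by (simp add: a_def add_nonneg_pos)
  have r_pos: "r n > 0" for n
    using lower[of n] a_pos[of "Suc n"] by simp
  have ratio: "(\<lambda>n. r (Suc n) / r n) \<longlonglongrightarrow> 1"
  proof (rule tendsto_sandwich)
    have "a (Suc (Suc n)) / a n \<le> (2 * r (Suc n)) / (2 * r n)" for n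
      using lower[of "Suc n"] upper[of n] r_pos a_pos by (intro frac_le) (auto intro: less_imp_le)
    then show "\<forall>\<^sub>F n in sequentially. a (Suc (Suc n)) / a n \<le> r (Suc n) / r n"
      by simp
    \<comment> \<open>The enclosures of \<open>2 * r (Suc n)\<close> and \<open>2 * r n\<close>
      share the endpoint \<open>a (Suc n)\<close>.\<close>
    have "r (Suc n) \<le> r n" for n
      using upper[of "Suc n"] lower[of n] by simp
    then show "\<forall>\<^sub>F n in sequentially. r (Suc n) / r n \<le> 1"
      using r_pos by simp
    show "(\<lambda>n. a (Suc (Suc n)) / a n) \<longlonglongrightarrow> 1"
      using assms unfolding a_def by real_asymp
  qed simp
  have "S_partial p q n \<noteq> S_total p q" for n
    using r_pos[of n] by (simp add: r_def)
  then have infra: "infra_linear_convergence (S_partial p q) (S_total p q)"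
    using ratio S_partial_tendsto_S_total[OF assms]
    by (simp add: infra_linear_convergence_def r_def abs_divide)
  have "r \<sim>[sequentially] (\<lambda>n. 1 / (2 * real p * real n))"
  \<comment> \<open>Neither the index shift nor \<open>q\<close> affects the leading term
    \<open>p * n\<close> of the denominators. The value \<open>1 / 0 = 0\<close> of the comparison
    sequence at \<open>n = 0\<close> is harmless, since the equivalence is eventual.\<close>
  proof (rule asymp_equiv_sandwich_real)
    show "(\<lambda>n. a (Suc n) / 2) \<sim>[sequentially] (\<lambda>n. 1 / (2 * real p * real n))"
      "(\<lambda>n. a n / 2) \<sim>[sequentially] (\<lambda>n. 1 / (2 * real p * real n))"
      using assms unfolding a_def by real_asymp+
    show "\<forall>\<^sub>F n in sequentially. r n \<in> {a (Suc n) / 2..a n / 2}"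
      using lower upper by (simp add: mult.commute)
  qed
  with infra show ?thesis
    by (simp add: r_def[abs_def])
qed

end
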